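(* Let $(r,\rho)\in\mathcal{NC}$. Then $M_{r,\rho}$ is a Lelek fan.
   Context: $\mathcal{NC}$ is the set of pairs $(r,\rho)$ of positive real numbers such that $r<1$, $\rho>1$, and for all integers $k,\ell$: $r^k=\rho^\ell$ if and only if $k=\ell=0$. For positive reals $r,\rho$, let $L_r=\{(x,y)\in[0,1]\times[0,1] : y=rx\}$, $L_\rho=\{(x,y)\in[0,1]\times[0,1] : y=\rho x\}$, $L_{r,\rho}=L_r\cup L_\rho$, and $$M_{r,\rho}=\Big\{(x_1,x_2,x_3,\ldots)\in\prod_{i=1}^\infty[0,1] : (x_i,x_{i+1})\in L_{r,\rho}\text{ for each positive integer } i\Big\},$$ with the subspace topology from the product topology on $\prod_{i=1}^\infty[0,1]$. A continuum is a non-empty compact connected metric space; a subcontinuum is a subspace of a continuum that is itself a continuum. A continuum $X$ is unicoherent if for any subcontinua $A,B$ of $X$ with $X=A\cup B$, the set $A\cap B$ is connected; it is hereditarily unicoherent if each of its subcontinua is unicoherent. A dendroid is an arcwise connected, hereditarily unicoherent continuum. An arc is a continuum homeomorphic to $[0,1]$; its end-points are the points corresponding to $0$ and $1$. A point $x$ of a dendroid $X$ is an end-point of $X$ if $x$ is an end-point of every arc in $X$ that contains $x$; $E(X)$ denotes the set of end-points of $X$. A simple triod is a continuum homeomorphic to $([-1,1]\times\{0\})\cup(\{0\}\times[0,1])$, and its top is the point corresponding to $(0,0)$. A point $x$ of a dendroid $X$ is a ramification-point of $X$ if there is a simple triod in $X$ with top $x$. A fan is a dendroid with at most one ramification-point,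 which is called the top of the fan (if it exists). For points $x\ne y$ of a fan $X$, $A[x,y]$ is the arc in $X$ with end-points $x$ and $y$, and $A[x,x]=\{x\}$. A fan $X$ with top $v$ is smooth if for every $x\in X$ and every sequence $(x_n)$ of points in $X$, $\lim_{n\to\infty}x_n=x$ implies $\lim_{n\to\infty}A[v,x_n]=A[v,x]$ with respect to the Hausdorff metric on non-empty closed subsets of $X$. A Lelek fan is a smooth fan $X$ such that the closure of $E(X)$ equals $X$. *)

theory Defs
  imports "HOL-Analysis.Analysis"
begin

section \<open>Continua, dendroids and fans\<close>

text \<open>Spaces are subsets of a metric space type, with the subspace metric.\<close>

definition continuum :: "'a::metric_space set \<Rightarrow> bool" where
  "continuum X \<longleftrightarrow> X \<noteq> {} \<and> compact X \<and> connected X"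

definition subcontinuum :: "'a::metric_space set \<Rightarrow> 'a set \<Rightarrow> bool" where
  "subcontinuum A X \<longleftrightarrow> A \<subseteq> X \<and> continuum A"

text \<open>The library's \<open>unicoherent\<close> speaks of relatively closed connected sets; the notion
  of continuum theory speaks of subcontinua. They agree on continua, see
  \<open>unicoherent_continuum_iff\<close> below.\<close>

definition unicoherent_continuum :: "'a::metric_space set \<Rightarrow> bool" where
  "unicoherent_continuum X \<longleftrightarrow> continuum X \<and>
     (\<forall>A B. subcontinuum A X \<and> subcontinuum B X \<and> X = A \<union> B \<longrightarrow> connected (A \<inter> B))"

definition hereditarily_unicoherent :: "'a::metric_space set \<Rightarrow> bool" where
  "hereditarily_unicoherent X \<longleftrightarrow> continuum X \<and>
     (\<forall>Y. subcontinuum Y X \<longrightarrow> unicoherent_continuum Y)"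

definition arc_between :: "'a::metric_space set \<Rightarrow> 'a \<Rightarrow> 'a \<Rightarrow> bool" where
  "arc_between A a b \<longleftrightarrow> continuum A \<and>
     (\<exists>h g. homeomorphism {0..1::real} A h g \<and> h 0 = a \<and> h 1 = b)"

definition arcwise_connected :: "'a::metric_space set \<Rightarrow> bool" where
  "arcwise_connected X \<longleftrightarrow>
     (\<forall>x\<in>X. \<forall>y\<in>X. x \<noteq> y \<longrightarrow> (\<exists>A\<subseteq>X. arc_between A x y))"

definition dendroid :: "'a::metric_space set \<Rightarrow> bool" where
  "dendroid X \<longleftrightarrow> continuum X \<and> arcwise_connected X \<and> hereditarily_unicoherent X"

definition end_points :: "'a::metric_space set \<Rightarrow> 'a set" where
  "end_points X = {x \<in> X. \<forall>A a b. A \<subseteq> X \<and> arc_between A a b \<and> x \<in> A \<longrightarrow> x = a \<or> x = b}"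

definition std_triod :: "(real \<times> real) set" where
  "std_triod = ({-1..1} \<times> {0}) \<union> ({0} \<times> {0..1})"

definition simple_triod :: "'a::metric_space set \<Rightarrow> 'a \<Rightarrow> bool" where
  "simple_triod T v \<longleftrightarrow> continuum T \<and>
     (\<exists>h g. homeomorphism std_triod T h g \<and> h (0, 0) = v)"

definition ramification_point :: "'a::metric_space set \<Rightarrow> 'a \<Rightarrow> bool" where
  "ramification_point X x \<longleftrightarrow> x \<in> X \<and> (\<exists>T\<subseteq>X. simple_triod T x)"

definition fan :: "'a::metric_space set \<Rightarrow> bool" where
  "fan X \<longleftrightarrow> dendroid X \<and>
     (\<forall>v w. ramification_point X v \<and> ramification_point X w \<longrightarrow> v = w)"

definition fan_with_top :: "'a::metric_space set \<Rightarrow> 'a \<Rightarrow> bool" where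
  "fan_with_top X v \<longleftrightarrow> fan X \<and> ramification_point X v"

text \<open>In a dendroid the arc between two distinct points exists and is unique.\<close>

definition the_arc :: "'a::metric_space set \<Rightarrow> 'a \<Rightarrow> 'a \<Rightarrow> 'a set" where
  "the_arc X x y = (if x = y then {x} else (THE A. A \<subseteq> X \<and> arc_between A x y))"

text \<open>A genuine distance only between non-empty compact sets; otherwise the suprema may be
  unspecified.\<close>

definition hausdorff_dist :: "'a::metric_space set \<Rightarrow> 'a set \<Rightarrow> real" where
  "hausdorff_dist A B = max (SUP a\<in>A. infdist a B) (SUP b\<in>B. infdist b A)"

definition smooth_fan :: "'a::metric_space set \<Rightarrow> bool" where
  "smooth_fan X \<longleftrightarrow> (\<exists>v. fan_with_top X v \<and>
     (\<forall>x\<in>X. \<forall>s::nat \<Rightarrow> 'a. (\<forall>n. s n \<in> X) \<and> s \<longlonglongrightarrow> x \<longrightarrow>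
        (\<lambda>n. hausdorff_dist (the_arc X v (s n)) (the_arc X v x)) \<longlonglongrightarrow> 0))"

definition Lelek_fan :: "'a::metric_space set \<Rightarrow> bool" where
  "Lelek_fan X \<longleftrightarrow> smooth_fan X \<and> closure (end_points X) = X"

lemma unicoherent_continuum_iff:
  "unicoherent_continuum X \<longleftrightarrow> continuum X \<and> unicoherent X"
proof (intro iffI conjI)
  assume u: "unicoherent_continuum X"
  then show c: "continuum X"
    by (simp add: unicoherent_continuum_def)
  show "unicoherent X"
  proof
    fix S T
    assume *: "connected S" "connected T" "X = S \<union> T"
      "closedin (top_of_set X) S" "closedin (top_of_set X) T"
    then have "compact S" "compact T"
      using c closedin_compact unfolding continuum_def by blast+
    show "connected (S \<inter> T)"
    proof (cases "S = {} \<or> T = {}")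
      case False
      then have "subcontinuum S X" "subcontinuum T X"
        using * \<open>compact S\<close> \<open>compact T\<close> by (auto simp: subcontinuum_def continuum_def)
      then show ?thesis
        using u * unfolding unicoherent_continuum_def by blast
    qed auto
  qed
next
  assume "continuum X \<and> unicoherent X"
  moreover have "closedin (top_of_set X) A" if "subcontinuum A X" for A
    using that by (simp add: subcontinuum_def continuum_def closed_subset compact_imp_closed)
  ultimately show "unicoherent_continuum X"
    unfolding unicoherent_continuum_def
    by (metis continuum_def subcontinuum_def unicoherentD)
qed

section \<open>The Mahavier product\<close>

definition NC :: "(real \<times> real) set" where
  "NC = {(r, \<rho>). 0 < r \<and> 0 < \<rho> \<and> r < 1 \<and> \<rho> > 1 \<and>
     (\<forall>k l::int. r powi k = \<rho> powi l \<longleftrightarrow> k = 0 \<and> l = 0)}"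

definition L_line :: "real \<Rightarrow> (real \<times> real) set" where
  "L_line a = {(x, y) \<in> {0..1} \<times> {0..1}. y = a * x}"

definition L_pair :: "real \<Rightarrow> real \<Rightarrow> (real \<times> real) set" where
  "L_pair r \<rho> = L_line r \<union> L_line \<rho>"

text \<open>Sequences are indexed from 0. The topology on \<^typ>\<open>nat \<Rightarrow> real\<close> is the product
  topology, induced by the metric of \<^theory>\<open>HOL-Analysis.Function_Metric\<close>.\<close>

definition M :: "real \<Rightarrow> real \<Rightarrow> (nat \<Rightarrow> real) set" where
  "M r \<rho> = {x. (\<forall>i. x i \<in> {0..1}) \<and> (\<forall>i. (x i, x (Suc i)) \<in> L_pair r \<rho>)}"

end

theory Submission
  imports Defs
begin

text \<open>A nonzero point of \<open>M r \<rho>\<close> is a positive multiple of a fixed product sequence of factors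
  \<open>r\<close>, \<open>\<rho>\<close>, so \<open>M r \<rho>\<close> is a union of segments issuing from \<open>0\<close>, and the choice of factors is
  locally constant away from \<open>0\<close>. Hence a connected subset missing \<open>0\<close> lies on a single segment,
  and a subcontinuum containing \<open>0\<close> is star-shaped about \<open>0\<close>; this yields unicoherence, uniqueness
  of arcs and the top \<open>0\<close>. Scaling by \<open>s \<in> [0,1]\<close> does not increase distances, which gives
  smoothness. Points with a coordinate equal to \<open>1\<close> cannot be prolonged and are end-points; they are
  dense because \<open>ln r / ln \<rho>\<close> is irrational, so that the numbers \<open>1 / (r ^ k * \<rho> ^ l)\<close>, from which
  \<open>1\<close> is reached by \<open>k\<close> factors \<open>r\<close> followed by \<open>l\<close> factors \<open>\<rho>\<close>, are dense.\<close>

section \<open>Sequence space and arcs\<close>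

definition smul :: "real \<Rightarrow> (nat \<Rightarrow> real) \<Rightarrow> nat \<Rightarrow> real" where
  "smul t x = (\<lambda>i. t * x i)"

lemma smul_apply [simp]: "smul t x i = t * x i"
  by (simp add: smul_def)

lemma smul_0_left [simp]: "smul 0 x = (\<lambda>_. 0)"
  and smul_0_right [simp]: "smul t (\<lambda>_. 0) = (\<lambda>_. 0)"
  and smul_1 [simp]: "smul 1 x = x"
  by (auto simp: fun_eq_iff)

lemma continuous_on_smul [continuous_intros]:
  assumes "continuous_on S f"
  shows "continuous_on S (\<lambda>s. smul (f s) x)"
  by (intro continuous_on_coordinatewise_then_product) (auto intro!: continuous_intros assms)

lemma continuous_on_apply:
  "continuous_on S (\<lambda>x :: nat \<Rightarrow> real. x i)"
  by (rule continuous_on_product_then_coordinatewise[OF continuous_on_id])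

lemma closed_component_eq: "closed {x :: nat \<Rightarrow> real. x i = a * x j}"
  by (intro closed_Collect_eq continuous_on_mult continuous_on_const continuous_on_apply)

text \<open>The topology is coordinatewise convergence, and coordinate \<open>i\<close> of the
  \<open>n\<close>-th approximant is controlled as soon as \<open>n\<close> is at least
  \<open>i\<close>.\<close>

lemma closure_seqI:
  fixes x :: "nat \<Rightarrow> real"
  assumes "\<And>n. \<exists>y\<in>S. \<forall>i\<le>n. \<bar>y i - x i\<bar> \<le> inverse (real (Suc n))"
  shows "x \<in> closure S"
proof -
  obtain y where y: "\<And>n. y n \<in> S" "\<And>n i. i \<le> n \<Longrightarrow> \<bar>y n i - x i\<bar> \<le> inverse (real (Suc n))"
    using assms by metis
  have "(\<lambda>n. y n i) \<longlonglongrightarrow> x i" for i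
  proof (rule LIM_zero_cancel, rule Lim_null_comparison[OF _ LIMSEQ_inverse_real_of_nat])
    show "\<forall>\<^sub>F n in sequentially. norm (y n i - x i) \<le> inverse (real (Suc n))"
      using y(2)[of i] by (auto simp: eventually_sequentially)
  qed
  then have "y \<longlonglongrightarrow> x"
    using limitin_componentwise[of "\<lambda>_. euclideanreal" UNIV y x sequentially]
    by (simp add: euclidean_product_topology)
  then show ?thesis
    using y(1) closure_sequential by blast
qed

lemma compact_unit_cube: "compact {x :: nat \<Rightarrow> real. \<forall>i. x i \<in> {0..1}}"
proof -
  have "compactin (product_topology (\<lambda>_. euclideanreal) UNIV) (PiE UNIV (\<lambda>_. {0..1}))"
    by (subst compactin_PiE) auto
  then have "compact (PiE UNIV (\<lambda>_. {0..1}) :: (nat \<Rightarrow> real) set)"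
    by (simp add: euclidean_product_topology)
  moreover have "PiE UNIV (\<lambda>_. {0..1}) = {x :: nat \<Rightarrow> real. \<forall>i. x i \<in> {0..1}}"
    by (auto simp: PiE_def Pi_def)
  ultimately show ?thesis
    by (simp only:)
qed

text \<open>The metric is a weighted sum of truncated coordinate distances, so a termwise comparison
  suffices once both series are known to converge.\<close>

lemma dist_smul_le:
  assumes "0 \<le> s" "s \<le> 1"
  shows "dist (smul s x) (smul s y) \<le> dist x y"
proof -
  have s: "summable (\<lambda>n. (1/2)^n * min (dist (u (from_nat n)) (v (from_nat n))) 1)"
    for u v :: "nat \<Rightarrow> real"
    by (rule summable_comparison_test'[of "\<lambda>n. (1/2)^n"]) (auto simp: summable_geometric_iff)
  have "dist (s * a) (s * b) \<le> dist a b" for a b :: real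
    using assms mult_right_mono[of s 1 "\<bar>a - b\<bar>"]
    by (simp add: dist_real_def abs_mult flip: right_diff_distrib)
  then show ?thesis
    unfolding dist_fun_def
    by (intro suminf_le s mult_left_mono min.mono) auto
qed

lemma arc_betweenI:
  fixes h :: "real \<Rightarrow> 'a::metric_space"
  assumes "continuous_on {0..1} h" "inj_on h {0..1}"
  shows "arc_between (h ` {0..1}) (h 0) (h 1)"
proof -
  obtain g where "homeomorphism {0..1} (h ` {0..1}) h g"
    using homeomorphism_compact[of "{0..1}" h] assms by auto
  then show ?thesis
    using assms unfolding arc_between_def continuum_def
    by (auto intro!: compact_continuous_image connected_continuous_image)
qed

lemma connected_component_smul:
  assumes "t \<le> 1" "\<And>s. t \<le> s \<Longrightarrow> s \<le> 1 \<Longrightarrow> smul s x \<in> S"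
  shows "connected_component S x (smul t x)"
  unfolding connected_component_def
proof (intro exI conjI)
  show "connected ((\<lambda>s. smul s x) ` {t..1})"
    by (intro connected_continuous_image continuous_intros) auto
  show "x \<in> (\<lambda>s. smul s x) ` {t..1}"
    using assms(1) by (auto intro!: image_eqI[where x = 1])
qed (use assms in auto)

lemma compact_std_triod: "compact std_triod"
  unfolding std_triod_def by (intro compact_Un compact_Times) auto

text \<open>The arm length is a parameter because a triod is later shrunk about its centre;
  \<open>e = 1\<close> is \<open>std_triod\<close>.\<close>

lemma connected_tripod: "0 \<le> e \<Longrightarrow> connected (({-e..e::real} \<times> {0::real}) \<union> ({0} \<times> {0..e}))"
proof (rule connected_Un)
  assume "0 \<le> e"
  then have "(0, 0) \<in> ({-e..e} \<times> {0}) \<inter> ({0} \<times> {0..e})" by auto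
  then show "({-e..e} \<times> {0}) \<inter> ({0} \<times> {0..e}) \<noteq> {}" by blast
qed (auto intro: connected_Times)

text \<open>Any two of the three arms form an interval, so a continuous injection to the line would
  put their ends on opposite sides of the image of the centre.\<close>

lemma no_inj_tripod_real:
  fixes f :: "real \<times> real \<Rightarrow> real"
  assumes e: "0 < e"
    and cont: "continuous_on (({-e..e} \<times> {0}) \<union> ({0} \<times> {0..e})) f"
    and inj: "inj_on f (({-e..e} \<times> {0}) \<union> ({0} \<times> {0..e}))"
  shows False
proof -
  let ?K = "({-e..e} \<times> {0}) \<union> ({0} \<times> {0..e})"
  have opp: "f (p (-e)) < f (p 0) \<and> f (p 0) < f (p e) \<or> f (p e) < f (p 0) \<and> f (p 0) < f (p (-e))"
    if p: "continuous_on {-e..e} p" "inj_on p {-e..e}" "p ` {-e..e} \<subseteq> ?K" for p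
  proof -
    have "continuous_on {-e..e} (f \<circ> p)"
      using p cont by (meson continuous_on_compose continuous_on_subset)
    moreover have "inj_on (f \<circ> p) {-e..e}"
      using p inj by (meson comp_inj_on inj_on_subset)
    ultimately show ?thesis
      using continuous_inj_imp_mono[of "-e" 0 e "f \<circ> p"] e by auto
  qed
  show False
    \<comment> \<open>The paths follow the arm pairs left-right, left-up and right-up. Of the three
      arm ends, two must lie on the same side of \<open>f (0, 0)\<close>.\<close>
    using opp[of "\<lambda>s. (s, 0)"] opp[of "\<lambda>s. (min s 0, max s 0)"] opp[of "\<lambda>s. (max (-s) 0, max s 0)"] e
    by (fastforce simp: inj_on_def min_def max_def intro!: continuous_intros split: if_splits)
qed

section \<open>The geometry of the Mahavier product\<close>

locale mahavier =
  fixes r \<rho> :: real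
  assumes r_pos: "0 < r" and r_less: "r < 1" and rho_gt: "1 < \<rho>"
begin

lemma rho_pos: "0 < \<rho>" and r_neq_rho: "r \<noteq> \<rho>"
  using r_less rho_gt by auto

lemma M_iff:
  "x \<in> M r \<rho> \<longleftrightarrow> (\<forall>i. 0 \<le> x i \<and> x i \<le> 1) \<and> (\<forall>i. x (Suc i) = r * x i \<or> x (Suc i) = \<rho> * x i)"
  by (auto simp: M_def L_pair_def L_line_def)

lemma M_nonneg: "x \<in> M r \<rho> \<Longrightarrow> 0 \<le> x i" and M_le_1: "x \<in> M r \<rho> \<Longrightarrow> x i \<le> 1"
  by (auto simp: M_iff)

lemma zero_in_M: "(\<lambda>_. 0) \<in> M r \<rho>"
  by (auto simp: M_iff)

lemma smul_in_M: "x \<in> M r \<rho> \<Longrightarrow> 0 \<le> s \<Longrightarrow> s \<le> 1 \<Longrightarrow> smul s x \<in> M r \<rho>"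
  unfolding M_iff by (auto simp: mult_le_one)

lemma M_eq_0: "x \<in> M r \<rho> \<Longrightarrow> x 0 = 0 \<Longrightarrow> x = (\<lambda>_. 0)"
proof (rule ext)
  fix i assume "x \<in> M r \<rho>" "x 0 = 0"
  then show "x i = 0"
    by (induction i) (auto simp: M_iff, metis mult_zero_right)
qed

lemma M_pos:
  assumes "x \<in> M r \<rho>" "x \<noteq> (\<lambda>_. 0)"
  shows "0 < x i"
proof (induction i)
  case 0
  show ?case using M_eq_0[OF assms(1)] M_nonneg[OF assms(1), of 0] assms(2) by force
next
  case (Suc i)
  then show ?case using assms(1) r_pos rho_pos unfolding M_iff by (metis mult_pos_pos)
qed

section \<open>Compactness and connectedness\<close>

lemma compact_M: "compact (M r \<rho>)"
proof -
  have "M r \<rho> = {x. \<forall>i. x i \<in> {0..1}} \<inter>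
      (\<Inter>i. {x. x (Suc i) = r * x i} \<union> {x. x (Suc i) = \<rho> * x i})"
    by (auto simp: M_iff)
  then show ?thesis
    by (simp only:) (intro compact_Int_closed compact_unit_cube closed_INT ballI closed_Un closed_component_eq)
qed

lemma connected_M: "connected (M r \<rho>)"
proof -
  have "connected_component (M r \<rho>) x (\<lambda>_. 0)" if "x \<in> M r \<rho>" for x
    using connected_component_smul[of 0 x "M r \<rho>"] smul_in_M[OF that] by simp
  then show ?thesis
    unfolding connected_iff_connected_component
    by (meson connected_component_sym connected_component_trans)
qed

lemma continuum_M: "continuum (M r \<rho>)"
  using compact_M connected_M zero_in_M unfolding continuum_def by blast

text \<open>Away from \<open>0\<close> the quotients of consecutive coordinates are continuous with values in
  \<open>{r, \<rho>}\<close>.\<close>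

lemma connected_imp_collinear:
  assumes C: "connected C" "C \<subseteq> M r \<rho>" "(\<lambda>_. 0) \<notin> C" and xy: "x \<in> C" "y \<in> C"
  shows "y = smul (y 0 / x 0) x"
proof -
  have pos: "0 < w i" if "w \<in> C" for w i
    using M_pos that C by blast
  have eq: "x (Suc i) / x i = y (Suc i) / y i" for i
  proof -
    have "(\<lambda>w. w (Suc i) / w i) constant_on C"
    proof (rule continuous_finite_range_constant[OF C(1)])
      show "continuous_on C (\<lambda>w. w (Suc i) / w i)"
        using less_imp_neq[OF pos] by (intro continuous_on_divide continuous_on_apply) auto
      have "(\<lambda>w. w (Suc i) / w i) ` C \<subseteq> {r, \<rho>}"
      proof (rule image_subsetI)
        fix w assume w: "w \<in> C"
        then have "w \<in> M r \<rho>" using C(2) by blast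
        then have "w (Suc i) = r * w i \<or> w (Suc i) = \<rho> * w i" by (simp add: M_iff)
        then show "w (Suc i) / w i \<in> {r, \<rho>}" using pos[OF w, of i] by auto
      qed
      then show "finite ((\<lambda>w. w (Suc i) / w i) ` C)"
        by (rule finite_subset) auto
    qed
    then show ?thesis
      using xy by (auto simp: constant_on_def)
  qed
  have "y i = y 0 / x 0 * x i" for i
  proof (induction i)
    case 0
    then show ?case using pos[OF xy(1), of 0] by simp
  next
    case (Suc i)
    have "y (Suc i) = x (Suc i) / x i * y i"
      using eq[of i] pos[OF xy(2), of i] by simp
    also have "\<dots> = y 0 / x 0 * x (Suc i)"
      using Suc pos[OF xy(1), of i] by simp
    finally show ?case .
  qed
  then show ?thesis unfolding smul_def by (rule ext)
qed

text \<open>If no point of \<open>C\<close> agreed with \<open>smul s x\<close> up to coordinate \<open>n\<close>, then the points of \<open>C\<close>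
  whose first \<open>n\<close> quotients are those of \<open>x\<close> and whose first coordinate exceeds \<open>s * x 0\<close> would
  form a clopen set.\<close>

lemma star_shaped:
  assumes C: "compact C" "connected C" "C \<subseteq> M r \<rho>" "(\<lambda>_. 0) \<in> C"
    and x: "x \<in> C" and s: "0 \<le> s" "s \<le> 1"
  shows "smul s x \<in> C"
proof (cases "x = (\<lambda>_. 0) \<or> s = 0 \<or> s = 1")
  case True
  then show ?thesis using C x by auto
next
  case False
  then have s': "0 < s" "s < 1" and xpos: "\<And>i. 0 < x i"
    using s M_pos C x by auto
  have xM: "x \<in> M r \<rho>" using C x by blast
  have ex: "\<exists>w\<in>C. \<forall>i\<le>n. w i = s * x i" for n
  proof (rule ccontr)
    assume no: "\<not> ?thesis"
    define c where "c i = x (Suc i) / x i" for i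
    define A where "A = {w. s * x 0 \<le> w 0} \<inter> (\<Inter>i\<in>{..<n}. {w. w (Suc i) = c i * w i})"
    \<comment> \<open>As \<open>c i\<close> is \<open>r\<close> or \<open>\<rho>\<close>, the number
      \<open>r + \<rho> - c i\<close> is the other one. Thus \<open>A\<close> and \<open>B\<close>
      are both closed, yet complementary on \<open>C\<close> under the assumption
      \<open>no\<close>.\<close>
    define B where "B = {w. w 0 \<le> s * x 0} \<union> (\<Union>i\<in>{..<n}. {w. w (Suc i) = (r + \<rho> - c i) * w i})"
    have c: "c i = r \<or> c i = \<rho>" for i
      using xM xpos[of i] unfolding M_iff c_def by (metis less_irrefl nonzero_mult_div_cancel_right)
    have "closed A" "closed B"
      unfolding A_def B_def
      by (intro closed_Int closed_INT closed_Un closed_UN ballI closed_component_eq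
          closed_Collect_le continuous_intros continuous_on_apply finite_lessThan)+
    moreover have "C \<subseteq> A \<union> B"
    proof
      fix w assume "w \<in> C"
      then have w: "w \<in> M r \<rho>" using C by blast
      have "w (Suc i) = c i * w i \<or> w (Suc i) = (r + \<rho> - c i) * w i" for i
        using w c[of i] unfolding M_iff by (metis add_diff_cancel_left' add_diff_cancel_right')
      then show "w \<in> A \<union> B"
        unfolding A_def B_def by force
    qed
    \<comment> \<open>A common point has positive coordinates, so its quotients cannot take both
      values and only the bound on \<open>w 0\<close> can place it in \<open>B\<close>. Then
      \<open>w 0 = s * x 0\<close>, and equal quotients carry this up to coordinate
      \<open>n\<close>, against \<open>no\<close>.\<close>
    moreover have "A \<inter> B \<inter> C = {}"
    proof (rule ccontr)
      assume "A \<inter> B \<inter> C \<noteq> {}"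
      then obtain w where w: "w \<in> A" "w \<in> B" "w \<in> C" by blast
      have ge: "s * x 0 \<le> w 0" and step: "\<And>i. i < n \<Longrightarrow> w (Suc i) = c i * w i"
        using w(1) by (auto simp: A_def)
      have "0 < w 0" using ge s'(1) xpos[of 0] by (smt (verit) mult_pos_pos)
      then have wpos: "0 < w i" for i using M_pos w(3) C by force
      have "(r + \<rho> - c i) * w i \<noteq> c i * w i" for i
        using wpos[of i] c[of i] r_neq_rho by auto
      then have "w 0 \<le> s * x 0"
        using w(2) step unfolding B_def by (metis (mono_tags, lifting) UN_E Un_iff lessThan_iff mem_Collect_eq)
      then have "w 0 = s * x 0" using ge by simp
      then have "w i = s * x i" if "i \<le> n" for i
        using that
      proof (induction i)
        case (Suc i)
        then show ?case using step[of i] xpos[of i] by (simp add: c_def)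
      qed
      then show False using no w(3) by blast
    qed
    moreover have "x \<in> A" "(\<lambda>_. 0) \<in> B"
      using s' xpos less_imp_neq[OF xpos] by (auto simp: A_def B_def c_def less_imp_le)
    ultimately show False
      using C(2,4) x unfolding connected_closed by blast
  qed
  have "smul s x \<in> closure C"
  proof (rule closure_seqI)
    fix n
    show "\<exists>y\<in>C. \<forall>i\<le>n. \<bar>y i - smul s x i\<bar> \<le> inverse (real (Suc n))"
      using ex[of n] by force
  qed
  then show ?thesis
    using C(1) by (simp add: compact_imp_closed)
qed

text \<open>If \<open>C\<close> contains the origin this is star-shapedness. Otherwise
  \<open>C\<close> lies on a single ray, where the first coordinate determines the point and takes
  an interval of values.\<close>

lemma ray_convex:
  assumes C: "compact C" "connected C" "C \<subseteq> M r \<rho>"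
    and x: "x \<in> C" "smul t x \<in> C" and s: "0 \<le> t" "t \<le> s" "s \<le> 1"
  shows "smul s x \<in> C"
proof (cases "(\<lambda>_. 0) \<in> C")
  case True
  then show ?thesis using star_shaped C x s by auto
next
  case False
  then have xpos: "0 < x 0" using M_pos C x by blast
  have "connected ((\<lambda>w. w 0) ` C)"
    by (intro connected_continuous_image continuous_on_apply C)
  moreover have "t * x 0 \<in> (\<lambda>w. w 0) ` C" "x 0 \<in> (\<lambda>w. w 0) ` C"
    using x by (force intro: image_eqI[where x = "smul t x"])+
  moreover have "t * x 0 \<le> s * x 0" "s * x 0 \<le> x 0"
    using s xpos by auto
  ultimately have "s * x 0 \<in> (\<lambda>w. w 0) ` C"
    using connectedD_interval by blast
  then obtain w where "w \<in> C" "w 0 = s * x 0" by force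
  then show ?thesis
    using connected_imp_collinear[OF C(2,3) False x(1) \<open>w \<in> C\<close>] xpos by simp
qed

section \<open>Hereditary unicoherence\<close>

lemma connected_Int_subcontinua:
  assumes A: "compact A" "connected A" "A \<subseteq> M r \<rho>" and B: "compact B" "connected B" "B \<subseteq> M r \<rho>"
  shows "connected (A \<inter> B)"
proof -
  \<comment> \<open>Each of \<open>A\<close> and \<open>B\<close> contains the whole segment between
    two of its points on one ray, so the segment stays in the intersection.\<close>
  have ray: "connected_component (A \<inter> B) x (smul t x)"
    if "x \<in> A \<inter> B" "smul t x \<in> A \<inter> B" "0 \<le> t" "t \<le> 1" for x t
    using that ray_convex[OF A, of x t] ray_convex[OF B, of x t]
    by (intro connected_component_smul) auto
  have "connected_component (A \<inter> B) x y" if xy: "x \<in> A \<inter> B" "y \<in> A \<inter> B" for x y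
  proof (cases "(\<lambda>_. 0) \<in> A \<inter> B")
    case True
    then show ?thesis
      using ray[of x 0] ray[of y 0] xy connected_component_sym connected_component_trans by fastforce
  next
    \<comment> \<open>One of \<open>A\<close>, \<open>B\<close> misses the origin and hence lies on
      a single ray, which then carries all of \<open>A \<inter> B\<close>. Comparing first
      coordinates tells which of two points is a multiple of the other by a factor at most
      1.\<close>
    case False
    have pos: "0 < u 0" if "u \<in> A \<inter> B" for u
      using that False A(3) M_pos[of u 0] by blast
    have coll: "smul (v 0 / u 0) u = v" if "u \<in> A \<inter> B" "v \<in> A \<inter> B" for u v
      using that False A(2,3) B(2,3) connected_imp_collinear[of A u v] connected_imp_collinear[of B u v]
      by auto
    have le: "connected_component (A \<inter> B) u v" if "u \<in> A \<inter> B" "v \<in> A \<inter> B" "v 0 \<le> u 0" for u v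
      using ray[of u "v 0 / u 0"] coll[OF that(1,2)] pos[OF that(1)] pos[OF that(2)] that by simp
    show ?thesis
      using le[of x y] le[of y x] xy connected_component_sym[of _ y x] linear[of "x 0" "y 0"] by blast
  qed
  then show ?thesis
    unfolding connected_iff_connected_component by blast
qed

lemma hereditarily_unicoherent_M: "hereditarily_unicoherent (M r \<rho>)"
  unfolding hereditarily_unicoherent_def
proof (intro conjI allI impI continuum_M)
  fix Y assume Y: "subcontinuum Y (M r \<rho>)"
  have "connected (A \<inter> B)" if "subcontinuum A Y" "subcontinuum B Y" for A B
    using that Y unfolding subcontinuum_def continuum_def
    by (intro connected_Int_subcontinua) auto
  then show "unicoherent_continuum Y"
    using Y unfolding unicoherent_continuum_def subcontinuum_def by blast
qed

section \<open>Arcwise connectedness\<close>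

lemma arcwise_connected_M: "arcwise_connected (M r \<rho>)"
  unfolding arcwise_connected_def
proof (intro ballI impI)
  fix x y assume x: "x \<in> M r \<rho>" and y: "y \<in> M r \<rho>" and "x \<noteq> y"
  show "\<exists>A\<subseteq>M r \<rho>. arc_between A x y"
  \<comment> \<open>If all 2 by 2 minors vanish, the points lie on a common ray and the straight
    segment is an arc in the product. Otherwise the path through the origin is injective.\<close>
  proof (cases "\<forall>i j. x i * y j = x j * y i")
    case True
    define h where "h s = (\<lambda>i. (1 - s) * x i + s * y i)" for s :: real
    have "continuous_on {0..1} h"
      unfolding h_def by (intro continuous_on_coordinatewise_then_product continuous_intros)
    moreover have "inj_on h {0..1}"
    proof (rule inj_onI)
      obtain k where k: "x k \<noteq> y k" using \<open>x \<noteq> y\<close> by auto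
      fix s t assume "h s = h t"
      then have "h s k = h t k" by simp
      then have "(s - t) * (y k - x k) = 0"
        unfolding h_def by (simp add: algebra_simps)
      then show "s = t" using k by simp
    qed
    moreover have "h s \<in> M r \<rho>" if "0 \<le> s" "s \<le> 1" for s
    proof -
      have "h s i \<le> 1" for i
        using convex_bound_le[of "x i" 1 "y i" "1 - s" s] M_le_1[OF x] M_le_1[OF y] that
        by (simp add: h_def)
      moreover have "0 \<le> h s i" for i
        using that M_nonneg[OF x] M_nonneg[OF y] by (simp add: h_def)
      moreover have "h s (Suc i) = r * h s i \<or> h s (Suc i) = \<rho> * h s i" for i
      proof -
        \<comment> \<open>A zero sequence satisfies the recurrence with either factor, so it can
          share the factor of the other point.\<close>
        obtain c where c: "c = r \<or> c = \<rho>" "x (Suc i) = c * x i" "y (Suc i) = c * y i"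
        proof (cases "x = (\<lambda>_. 0) \<or> y = (\<lambda>_. 0)")
          case zero: True
          then show ?thesis using that x y by (fastforce simp: M_iff)
        next
          case False
          then have p: "0 < x i" "0 < y i" using M_pos x y by auto
          obtain c where c: "c = r \<or> c = \<rho>" "x (Suc i) = c * x i" using x by (auto simp: M_iff)
          then have "y (Suc i) = c * y i"
            using True[rule_format, of i "Suc i"] p by (auto simp: field_simps)
          then show ?thesis using c that by blast
        qed
        then have "h s (Suc i) = c * h s i"
          by (simp add: h_def algebra_simps)
        then show ?thesis using c(1) by blast
      qed
      ultimately show ?thesis by (auto simp: M_iff)
    qed
    ultimately show ?thesis
      using arc_betweenI[of h] by (intro exI[of _ "h ` {0..1}"]) (auto simp: h_def)
  next
    case False
    then obtain i j where ij: "x i * y j \<noteq> x j * y i" by blast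
    \<comment> \<open>From \<open>x\<close> down to the origin for \<open>s\<close> up to 1/2, then
      up to \<open>y\<close>; the truncations by \<open>max\<close> put both legs into one
      formula.\<close>
    define h where "h s = (\<lambda>i. max (1 - 2 * s) 0 * x i + max (2 * s - 1) 0 * y i)" for s :: real
    have "continuous_on {0..1} h"
      unfolding h_def by (intro continuous_on_coordinatewise_then_product continuous_intros)
    moreover have "inj_on h {0..1}"
    proof (rule inj_onI)
      fix s t assume "h s = h t"
      then have e: "(max (1 - 2 * s) 0 - max (1 - 2 * t) 0) * x k
            + (max (2 * s - 1) 0 - max (2 * t - 1) 0) * y k = 0" for k
        unfolding h_def fun_eq_iff by (simp add: algebra_simps)
      \<comment> \<open>Cramer's rule with the nonzero minor: \<open>x\<close> and \<open>y\<close>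
        are linearly independent.\<close>
      have "a = 0 \<and> b = 0" if "a * x i + b * y i = 0" "a * x j + b * y j = 0" for a b
      proof -
        have "a * (x i * y j - x j * y i) = (a * x i + b * y i) * y j - (a * x j + b * y j) * y i"
          "b * (x i * y j - x j * y i) = (a * x j + b * y j) * x i - (a * x i + b * y i) * x j"
          by (simp_all add: algebra_simps)
        then have "a * (x i * y j - x j * y i) = 0" "b * (x i * y j - x j * y i) = 0"
          using that by simp_all
        then show ?thesis using ij by simp
      qed
      from this[OF e e] show "s = t" by (auto simp: max_def split: if_splits)
    qed
    moreover have "h s \<in> M r \<rho>" if "0 \<le> s" "s \<le> 1" for s
    proof (cases "s \<le> 1/2")
      case True
      then have "h s = smul (1 - 2 * s) x" by (auto simp: h_def fun_eq_iff)
      then show ?thesis using True that x by (simp add: smul_in_M)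
    next
      case False
      then have "h s = smul (2 * s - 1) y" by (auto simp: h_def fun_eq_iff)
      then show ?thesis using False that y by (simp add: smul_in_M)
    qed
    ultimately show ?thesis
      using arc_betweenI[of h] by (intro exI[of _ "h ` {0..1}"]) (auto simp: h_def)
  qed
qed

lemma dendroid_M: "dendroid (M r \<rho>)"
  by (simp add: dendroid_def continuum_M arcwise_connected_M hereditarily_unicoherent_M)

text \<open>Points of \<open>C\<close> are multiples of one another and the ratio can be read off at
  coordinate 0. Arcs and triods that miss the origin are thereby transferred to the real
  line.\<close>

lemma collinear_inj:
  assumes "connected C" "C \<subseteq> M r \<rho>" "(\<lambda>_. 0) \<notin> C"
  shows "inj_on (\<lambda>w. w 0) C"
proof (rule inj_onI)
  fix u v assume uv: "u \<in> C" "v \<in> C" "u 0 = v 0"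
  then have "u 0 \<noteq> 0" using M_eq_0[of u] assms by blast
  then show "u = v" using connected_imp_collinear[OF assms uv(1,2)] uv(3) by simp
qed

section \<open>The origin as the only ramification point\<close>

lemma ramification_point_imp_0:
  assumes "ramification_point (M r \<rho>) v"
  shows "v = (\<lambda>_. 0)"
proof (rule ccontr)
  assume v: "v \<noteq> (\<lambda>_. 0)"
  obtain T h g where T: "T \<subseteq> M r \<rho>" "homeomorphism std_triod T h g" "h (0, 0) = v"
    using assms unfolding ramification_point_def simple_triod_def by auto
  define K where "K e = ({-e..e::real} \<times> {0::real}) \<union> ({0} \<times> {0..e})" for e
  have inj: "inj_on h std_triod" and cont: "continuous_on std_triod h" and img: "h ` std_triod = T"
    using T(2) unfolding homeomorphism_def by (auto intro: inj_on_inverseI)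
  \<comment> \<open>Shrink the triod about its centre until its image misses the origin, so that the
    first coordinate becomes injective on it.\<close>
  obtain e where e: "0 < e" "e \<le> 1" "(\<lambda>_. 0) \<notin> h ` K e"
  proof (cases "\<exists>p\<in>std_triod. h p = (\<lambda>_. 0)")
    case False
    then show ?thesis using that[of 1] unfolding K_def std_triod_def by force
  next
    case True
    then obtain p where p: "p \<in> std_triod" "h p = (\<lambda>_. 0)" by blast
    \<comment> \<open>\<open>K e\<close> consists of the triod points of maximum norm at most
      \<open>e\<close>. Half the norm of \<open>p\<close>, the only preimage of the origin, excludes
      \<open>p\<close>.\<close>
    define e where "e = max \<bar>fst p\<bar> \<bar>snd p\<bar> / 2"
    have "p \<noteq> (0, 0)" using p T(3) v by auto
    then have "0 < e" by (auto simp: e_def prod_eq_iff less_max_iff_disj)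
    moreover have "e \<le> 1" using p(1) by (auto simp: e_def std_triod_def)
    moreover have "(\<lambda>_. 0) \<notin> h ` K e"
    proof
      assume "(\<lambda>_. 0) \<in> h ` K e"
      then obtain q where q: "q \<in> K e" "h q = h p" using p by auto
      moreover have "q \<in> std_triod" using q \<open>e \<le> 1\<close> by (auto simp: K_def std_triod_def)
      ultimately have "p \<in> K e" using inj p(1) by (metis inj_onD)
      then show False using \<open>0 < e\<close> by (auto simp: K_def e_def)
    qed
    ultimately show ?thesis using that by blast
  qed
  have sub: "K e \<subseteq> std_triod" using e by (auto simp: K_def std_triod_def)
  have cK: "continuous_on (K e) h" using cont sub by (rule continuous_on_subset)
  have "connected (h ` K e)"
    using cK connected_tripod[of e] e by (intro connected_continuous_image) (auto simp: K_def)
  moreover have "h ` K e \<subseteq> M r \<rho>" using sub img T(1) by blast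
  ultimately have "inj_on (\<lambda>w. w 0) (h ` K e)" using collinear_inj e(3) by blast
  then have "inj_on (\<lambda>p. h p 0) (K e)"
    using comp_inj_on[OF inj_on_subset[OF inj sub], of "\<lambda>w. w 0"] by (simp add: o_def)
  moreover have "continuous_on (K e) (\<lambda>p. h p 0)"
    using cK by (rule continuous_on_product_then_coordinatewise)
  ultimately show False
    using no_inj_tripod_real[of e "\<lambda>p. h p 0"] e(1) unfolding K_def by blast
qed

lemma case_nat_in_M:
  assumes "y \<in> M r \<rho>" "0 \<le> a" "a \<le> 1" "y 0 = r * a \<or> y 0 = \<rho> * a"
  shows "case_nat a y \<in> M r \<rho>"
  using assms unfolding M_iff by (auto split: nat.split)

lemma powers_in_M: "(\<lambda>i. r ^ i) \<in> M r \<rho>"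
  unfolding M_iff using r_pos r_less by (auto simp: power_le_one)

lemma ramification_point_0: "ramification_point (M r \<rho>) (\<lambda>_. 0)"
proof -
  \<comment> \<open>Three rays whose factors begin with \<open>r\<close>, \<open>r\<close>, with
    \<open>\<rho>\<close>, \<open>r\<close> and with \<open>r\<close>, \<open>\<rho>\<close>, all
    later factors being \<open>r\<close>. The initial value \<open>1/\<rho>\<close> keeps the
    coordinates at most 1.\<close>
  define u where "u = (\<lambda>i. r ^ i)"
  define v where "v = case_nat (1/\<rho>) u"
  define w where "w = case_nat (1/\<rho>) (smul r v)"
  have uM: "u \<in> M r \<rho>" unfolding u_def by (rule powers_in_M)
  have vM: "v \<in> M r \<rho>"
    unfolding v_def using rho_gt by (intro case_nat_in_M uM) (auto simp: u_def)
  have "smul r v \<in> M r \<rho>" using vM r_pos r_less by (simp add: smul_in_M)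
  then have wM: "w \<in> M r \<rho>"
    unfolding w_def using rho_gt by (intro case_nat_in_M) (auto simp: v_def)
  \<comment> \<open>The right, left and upper arms go to the segments towards \<open>u\<close>,
    \<open>v\<close> and \<open>w\<close>.\<close>
  define h where "h p = (\<lambda>i. max (fst p) 0 * u i + max (- fst p) 0 * v i + snd p * w i)"
    for p :: "real \<times> real"
  have cont: "continuous_on std_triod h"
    unfolding h_def by (intro continuous_on_coordinatewise_then_product continuous_intros)
  \<comment> \<open>Coordinates 0, 1 and 2 already force linear independence, which makes
    \<open>h\<close> injective.\<close>
  have indep: "a = 0 \<and> b = 0 \<and> c = 0"
    if "\<And>i. a * u i + b * v i + c * w i = 0" for a b c
  proof -
    have 0: "a + b / \<rho> + c / \<rho> = 0" and 1: "a * r + b + c * (r / \<rho>) = 0"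
      and 2: "a * r\<^sup>2 + b * r + c * r = 0"
      using that[of 0] that[of "Suc 0"] that[of "Suc (Suc 0)"]
      by (simp_all add: u_def v_def w_def power2_eq_square)
    have bc: "b + c = - \<rho> * a" using 0 rho_pos by (simp add: field_simps)
    have "r * (a * r + (b + c)) = 0" using 2 by (simp add: power2_eq_square algebra_simps)
    then have "a * (r - \<rho>) = 0" using r_pos bc by (simp add: algebra_simps)
    then have "a = 0" using r_neq_rho by simp
    then have "c = - b" using bc by simp
    then have "b * (\<rho> - r) = 0" using 1 \<open>a = 0\<close> rho_pos by (simp add: field_simps)
    then show ?thesis using \<open>a = 0\<close> \<open>c = - b\<close> r_neq_rho by simp
  qed
  have inj: "inj_on h std_triod"
  proof (rule inj_onI)
    fix p q assume "h p = h q"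
    then have "(max (fst p) 0 - max (fst q) 0) * u i + (max (- fst p) 0 - max (- fst q) 0) * v i
        + (snd p - snd q) * w i = 0" for i
      unfolding h_def fun_eq_iff by (simp add: algebra_simps)
    from indep[OF this] show "p = q"
      by (auto simp: prod_eq_iff max_def split: if_splits)
  qed
  have in_M: "h p \<in> M r \<rho>" if p: "p \<in> std_triod" for p
  proof -
    consider "0 \<le> fst p" "fst p \<le> 1" "snd p = 0" | "fst p \<le> 0" "-1 \<le> fst p" "snd p = 0"
      | "fst p = 0" "0 \<le> snd p" "snd p \<le> 1"
      using p unfolding std_triod_def by force
    then show ?thesis
    proof cases
      case 1
      then have "h p = smul (fst p) u" by (auto simp: h_def fun_eq_iff)
      then show ?thesis using 1 uM by (simp add: smul_in_M)
    next
      case 2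
      then have "h p = smul (- fst p) v" by (auto simp: h_def fun_eq_iff)
      then show ?thesis using 2 vM by (simp add: smul_in_M)
    next
      case 3
      then have "h p = smul (snd p) w" by (auto simp: h_def fun_eq_iff)
      then show ?thesis using 3 wM by (simp add: smul_in_M)
    qed
  qed
  obtain g where g: "homeomorphism std_triod (h ` std_triod) h g"
    using homeomorphism_compact[OF compact_std_triod cont refl inj] by blast
  have "connected std_triod" using connected_tripod[of 1] by (simp add: std_triod_def)
  then have "continuum (h ` std_triod)"
    unfolding continuum_def using cont compact_std_triod
    by (auto simp: std_triod_def intro!: compact_continuous_image connected_continuous_image)
  moreover have "h (0, 0) = (\<lambda>_. 0)" by (auto simp: h_def)
  ultimately show ?thesis
    unfolding ramification_point_def simple_triod_def using g in_M zero_in_M by blast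
qed

lemma fan_with_top_M: "fan_with_top (M r \<rho>) (\<lambda>_. 0)"
  unfolding fan_with_top_def fan_def
  using dendroid_M ramification_point_0 ramification_point_imp_0 by metis

section \<open>Arcs from the top and smoothness\<close>

lemma the_arc_M:
  assumes x: "x \<in> M r \<rho>"
  shows "the_arc (M r \<rho>) (\<lambda>_. 0) x = (\<lambda>s. smul s x) ` {0..1}"
proof (cases "x = (\<lambda>_. 0)")
  case True
  then show ?thesis by (auto simp: the_arc_def image_constant_conv)
next
  case False
  let ?S = "(\<lambda>s. smul s x) ` {0..1}"
  have "inj_on (\<lambda>s. smul s x) {0..1}"
    using M_pos[OF x False, of 0] by (auto simp: inj_on_def dest: fun_cong[of _ _ 0])
  then have arc: "arc_between ?S (\<lambda>_. 0) x"
    using arc_betweenI[of "\<lambda>s. smul s x"] continuous_on_smul[OF continuous_on_id] by simp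
  have "(THE A. A \<subseteq> M r \<rho> \<and> arc_between A (\<lambda>_. 0) x) = ?S"
  proof (rule the_equality)
    show "?S \<subseteq> M r \<rho> \<and> arc_between ?S (\<lambda>_. 0) x"
      using arc x by (auto intro: smul_in_M)
  next
    \<comment> \<open>A competing arc contains the segment by star-shapedness. The inverse
      parametrization sends the segment to a connected subset of \<open>{0..1}\<close> containing
      both ends, so the segment is the whole arc.\<close>
    fix A assume A: "A \<subseteq> M r \<rho> \<and> arc_between A (\<lambda>_. 0) x"
    then obtain h g where h: "homeomorphism {0..1::real} A h g" "h 0 = (\<lambda>_. 0)" "h 1 = x"
      and AC: "compact A" "connected A"
      unfolding arc_between_def continuum_def by auto
    have img: "h ` {0..1} = A" and gh: "\<And>s. s \<in> {0..1} \<Longrightarrow> g (h s) = s"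
      and hg: "\<And>y. y \<in> A \<Longrightarrow> h (g y) = y" and gA: "g ` A = {0..1}" and cont: "continuous_on A g"
      using h(1) by (simp_all add: homeomorphism_def)
    have "h 0 \<in> A" "h 1 \<in> A"
      unfolding img[symmetric] by (rule imageI, simp)+
    then have mem: "(\<lambda>_. 0) \<in> A" "x \<in> A"
      using h by simp_all
    then have sub: "?S \<subseteq> A"
      using star_shaped[OF AC] A by auto
    have "connected (g ` ?S)"
      by (intro connected_continuous_image continuous_on_subset[OF cont sub] continuous_on_smul
          continuous_on_id connected_Icc)
    moreover have "g (\<lambda>_. 0) = 0" "g x = 1"
      using gh[of 0] gh[of 1] h(2,3) by simp_all
    moreover have "(\<lambda>_. 0) \<in> ?S" "x \<in> ?S"
      by (rule image_eqI[where x = 0], simp, simp, rule image_eqI[where x = 1], simp, simp)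
    ultimately have "{0..1} \<subseteq> g ` ?S"
      by (metis connected_contains_Icc imageI)
    then have "h ` {0..1} \<subseteq> h ` g ` ?S"
      by (rule image_mono)
    also have "\<dots> \<subseteq> ?S"
      using sub hg by (auto simp: subset_iff)
    finally show "A = ?S" using sub img by blast
  qed
  then show ?thesis using False by (auto simp: the_arc_def)
qed

text \<open>Pair points with the same parameter: scaling does not increase distances. The lower
  bound 0 is included for the squeeze that proves smoothness.\<close>

lemma hausdorff_dist_segments_le:
  "hausdorff_dist ((\<lambda>s. smul s x) ` {0..1}) ((\<lambda>s. smul s y) ` {0..1}) \<in> {0..dist x y}"
proof -
  have le: "infdist a ((\<lambda>s. smul s v) ` {0..1}) \<le> dist u v" if "a \<in> (\<lambda>s. smul s u) ` {0..1}" for a u v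
  proof -
    from that obtain s where s: "s \<in> {0..1}" "a = smul s u" by blast
    then have "infdist a ((\<lambda>s. smul s v) ` {0..1}) \<le> dist a (smul s v)"
      by (intro infdist_le) auto
    also have "\<dots> \<le> dist u v" using s dist_smul_le by auto
    finally show ?thesis .
  qed
  have sup: "(SUP a\<in>(\<lambda>s. smul s u) ` {0..1}. infdist a ((\<lambda>s. smul s v) ` {0..1})) \<in> {0..dist u v}" for u v
  proof -
    have "bdd_above ((\<lambda>a. infdist a ((\<lambda>s. smul s v) ` {0..1})) ` (\<lambda>s. smul s u) ` {0..1})"
      using le[of _ u v] by (intro bdd_aboveI2) blast
    moreover have "u \<in> (\<lambda>s. smul s u) ` {0..1}"
      by (auto intro!: image_eqI[where x = "1::real"])
    ultimately have "infdist u ((\<lambda>s. smul s v) ` {0..1}) \<le>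
        (SUP a\<in>(\<lambda>s. smul s u) ` {0..1}. infdist a ((\<lambda>s. smul s v) ` {0..1}))"
      by (rule cSUP_upper[rotated])
    moreover have "(SUP a\<in>(\<lambda>s. smul s u) ` {0..1}. infdist a ((\<lambda>s. smul s v) ` {0..1})) \<le> dist u v"
      using le[of _ u v] by (intro cSUP_least) auto
    ultimately show ?thesis by (auto intro: order_trans[OF infdist_nonneg])
  qed
  show ?thesis
    unfolding hausdorff_dist_def using sup[of x y] sup[of y x] by (auto simp: dist_commute le_max_iff_disj)
qed

lemma smooth_fan_M: "smooth_fan (M r \<rho>)"
  unfolding smooth_fan_def
proof (intro exI conjI ballI allI impI)
  show "fan_with_top (M r \<rho>) (\<lambda>_. 0)" by (rule fan_with_top_M)
  fix x s assume x: "x \<in> M r \<rho>" and s: "(\<forall>n. s n \<in> M r \<rho>) \<and> s \<longlonglongrightarrow> x"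
  have "(\<lambda>n. hausdorff_dist ((\<lambda>t. smul t (s n)) ` {0..1}) ((\<lambda>t. smul t x) ` {0..1})) \<longlonglongrightarrow> 0"
  proof (rule tendsto_sandwich[of "\<lambda>_. 0" _ _ "\<lambda>n. dist (s n) x"])
    show "(\<lambda>n. dist (s n) x) \<longlonglongrightarrow> 0" using s tendsto_dist_iff by blast
  qed (use hausdorff_dist_segments_le in auto)
  then show "(\<lambda>n. hausdorff_dist (the_arc (M r \<rho>) (\<lambda>_. 0) (s n)) (the_arc (M r \<rho>) (\<lambda>_. 0) x)) \<longlonglongrightarrow> 0"
    using x s by (simp add: the_arc_M)
qed

section \<open>End-points\<close>

text \<open>With a coordinate equal to 1, \<open>x\<close> is the farthest point of its ray. Inside
  an arc it would have neighbours on both sides along that ray, one of them farther out.\<close>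

lemma end_pointI:
  assumes x: "x \<in> M r \<rho>" and i: "x i = 1"
  shows "x \<in> end_points (M r \<rho>)"
  unfolding end_points_def
proof (clarsimp simp: x)
  fix A a b assume A: "A \<subseteq> M r \<rho>" "arc_between A a b" "x \<in> A" and "x \<noteq> b"
  obtain h g where h: "homeomorphism {0..1::real} A h g" "h 0 = a" "h 1 = b"
    using A(2) unfolding arc_between_def by auto
  have inj: "inj_on h {0..1}" and cont: "continuous_on {0..1} h" and img: "h ` {0..1} = A"
    using h(1) unfolding homeomorphism_def by (auto intro: inj_on_inverseI)
  obtain t where t: "0 \<le> t" "t \<le> 1" "h t = x" using img A(3) by auto
  show "x = a"
  proof (rule ccontr)
    assume "x \<noteq> a"
    then have t': "0 < t" "t < 1"
      using t h \<open>x \<noteq> b\<close> by (auto simp: less_le)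
    have x0: "x \<noteq> (\<lambda>_. 0)" using i by auto
    \<comment> \<open>The arc meets the origin for at most one parameter \<open>z\<close>; stopping
      midway between \<open>z\<close> and \<open>t\<close> avoids it.\<close>
    obtain c d where cd: "0 \<le> c" "c < t" "t < d" "d \<le> 1" "(\<lambda>_. 0) \<notin> h ` {c..d}"
    proof (cases "(\<lambda>_. 0) \<in> h ` {0..1}")
      case False
      then show ?thesis using that[of 0 1] t' by simp
    next
      case True
      then obtain z where z: "0 \<le> z" "z \<le> 1" "h z = (\<lambda>_. 0)" by auto
      have uniq: "w = z" if "w \<in> {0..1}" "h w = (\<lambda>_. 0)" for w
        using inj z that by (metis atLeastAtMost_iff inj_onD)
      have "z \<noteq> t" using z t x0 by auto
      then consider "z < t" | "t < z" by linarith
      then show ?thesis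
      proof cases
        case 1
        show ?thesis
        proof (rule that[of "(z + t) / 2" 1])
          show "(\<lambda>_. 0) \<notin> h ` {(z + t) / 2..1}"
          proof
            assume "(\<lambda>_. 0) \<in> h ` {(z + t) / 2..1}"
            then obtain w where "(z + t) / 2 \<le> w" "w \<le> 1" "h w = (\<lambda>_. 0)" by auto
            then show False using uniq[of w] 1 z by auto
          qed
        qed (use 1 z t' in auto)
      next
        case 2
        show ?thesis
        proof (rule that[of 0 "(z + t) / 2"])
          show "(\<lambda>_. 0) \<notin> h ` {0..(z + t) / 2}"
          proof
            assume "(\<lambda>_. 0) \<in> h ` {0..(z + t) / 2}"
            then obtain w where "w \<le> (z + t) / 2" "0 \<le> w" "h w = (\<lambda>_. 0)" by auto
            then show False using uniq[of w] 2 z by auto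
          qed
        qed (use 2 z t' in auto)
      qed
    qed
    define C where "C = h ` {c..d}"
    have sub: "{c..d} \<subseteq> {0..1}" using cd by auto
    have chd: "continuous_on {c..d} h" using cont sub by (rule continuous_on_subset)
    have C: "connected C" "C \<subseteq> M r \<rho>" "(\<lambda>_. 0) \<notin> C"
      using chd sub img A(1) cd(5) by (auto simp: C_def intro!: connected_continuous_image)
    have xC: "x \<in> C" using t cd by (auto simp: C_def)
    have "inj_on (\<lambda>s. h s 0) {c..d}"
      using comp_inj_on[OF inj_on_subset[OF inj sub], of "\<lambda>w. w 0"] collinear_inj[OF C]
      by (simp add: o_def C_def)
    moreover have "continuous_on {c..d} (\<lambda>s. h s 0)"
      using chd by (rule continuous_on_product_then_coordinatewise)
    \<comment> \<open>The first coordinate is strictly monotone on \<open>{c..d}\<close>, so it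
      exceeds \<open>x 0\<close> at one of the two ends.\<close>
    ultimately have "x 0 < h c 0 \<or> x 0 < h d 0"
      using continuous_inj_imp_mono[of c t d "\<lambda>s. h s 0"] cd t by auto
    moreover have "w 0 \<le> x 0" if "w \<in> C" for w
    proof -
      have "w i = w 0 / x 0 * x i"
        using connected_imp_collinear[OF C xC that] by (metis smul_apply)
      moreover have "w i \<le> 1" using that C M_le_1 by blast
      ultimately show ?thesis using i M_pos[OF x x0, of 0] by simp
    qed
    moreover have "h c \<in> C" "h d \<in> C" using cd by (auto simp: C_def)
    ultimately show False by (meson not_less)
  qed
qed

section \<open>Approximation by end-points\<close>

lemma splice_in_M:
  assumes x: "x \<in> M r \<rho>" and y: "y \<in> M r \<rho>" and eq: "y 0 = x n"
  shows "(\<lambda>i. if i < n then x i else y (i - n)) \<in> M r \<rho>"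
  unfolding M_iff
proof (intro conjI allI)
  fix i
  let ?z = "\<lambda>i. if i < n then x i else y (i - n)"
  show "0 \<le> ?z i" "?z i \<le> 1" using x y by (auto simp: M_iff)
  consider "Suc i < n" | "Suc i = n" | "n \<le> i" by linarith
  then show "?z (Suc i) = r * ?z i \<or> ?z (Suc i) = \<rho> * ?z i"
  proof cases
    \<comment> \<open>At the joint the next coordinate is \<open>y 0\<close>, which equals
      \<open>x n\<close>, so this is a step of \<open>x\<close>.\<close>
    case 2
    then show ?thesis using eq x by (auto simp: M_iff)
  next
    case 3
    then show ?thesis using y by (auto simp: M_iff Suc_diff_le)
  qed (use x in \<open>auto simp: M_iff\<close>)
qed

text \<open>The sequence is built backwards from the powers of \<open>r\<close>, which start at 1.
  Having all factors \<open>r\<close> precede the factors \<open>\<rho>\<close> keeps every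
  coordinate at most 1: the values first fall, then rise to exactly 1.\<close>

lemma reaches_1:
  assumes "1 / (r ^ k * \<rho> ^ l) \<le> 1"
  shows "\<exists>y\<in>M r \<rho>. y 0 = 1 / (r ^ k * \<rho> ^ l) \<and> (\<exists>i. y i = 1)"
  using assms
proof (induction k)
  case 0
  show ?case
  proof (induction l)
    case 0
    show ?case by (rule bexI[OF _ powers_in_M]) (auto intro: exI[of _ 0])
  next
    case (Suc l)
    then obtain y i where y: "y \<in> M r \<rho>" "y 0 = 1 / \<rho> ^ l" "y i = 1" by auto
    have "\<rho> ^ Suc l \<ge> 1" using rho_gt by (intro one_le_power) simp
    then have "case_nat (1 / \<rho> ^ Suc l) y \<in> M r \<rho>"
      using y rho_pos by (intro case_nat_in_M) auto
    then show ?case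
      using y(3) by (intro bexI[of _ "case_nat (1 / \<rho> ^ Suc l) y"]) (auto intro: exI[of _ "Suc i"])
  qed
next
  case (Suc k)
  have pos: "0 < r ^ k * \<rho> ^ l" using r_pos rho_pos by simp
  have "1 / (r ^ k * \<rho> ^ l) = r * (1 / (r ^ Suc k * \<rho> ^ l))"
    using r_pos by (simp add: field_simps)
  also have "\<dots> \<le> 1"
    using Suc.prems r_pos r_less rho_pos by (intro mult_le_one) auto
  finally obtain y i where y: "y \<in> M r \<rho>" "y 0 = 1 / (r ^ k * \<rho> ^ l)" "y i = 1"
    using Suc.IH by blast
  have "case_nat (1 / (r ^ Suc k * \<rho> ^ l)) y \<in> M r \<rho>"
    using y r_pos rho_pos Suc.prems by (intro case_nat_in_M) auto
  then show ?case
    using y(3) by (intro bexI[of _ "case_nat (1 / (r ^ Suc k * \<rho> ^ l)) y"]) (auto intro: exI[of _ "Suc i"])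
qed

end

text \<open>A quotient \<open>m / n\<close> would give \<open>r powi n = \<rho> powi m\<close> with
  \<open>n\<close> nonzero.\<close>

lemma NC_irrational:
  assumes "(r, \<rho>) \<in> NC"
  shows "ln r / ln \<rho> \<notin> \<rat>"
proof
  have pos: "0 < r" "r < 1" "1 < \<rho>" using assms by (auto simp: NC_def)
  have nc: "r powi k = \<rho> powi l \<longleftrightarrow> k = 0 \<and> l = 0" for k l
    using assms by (auto simp: NC_def)
  assume "ln r / ln \<rho> \<in> \<rat>"
  then obtain m n :: int where mn: "n \<noteq> 0" "ln r / ln \<rho> = m / n"
    by (metis Rats_cases' less_irrefl)
  then have "n * ln r = m * ln \<rho>"
    using pos by (simp add: field_simps)
  then have "r powr n = \<rho> powr m"
    using pos by (simp add: powr_def)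
  then have "r powi n = \<rho> powi m"
    using pos by (simp add: powr_real_of_int')
  then show False using nc mn(1) by blast
qed

text \<open>In logarithms to base \<open>\<rho>\<close>, the task is to place
  \<open>k * \<theta> - l\<close> just below the logarithm of \<open>v\<close>. Kronecker's theorem
  supplies \<open>k\<close> by approximating fractional parts, and \<open>l\<close> absorbs the
  integer parts.\<close>

lemma NC_dense:
  assumes "(r, \<rho>) \<in> NC" and v: "0 < v" "v \<le> 1" and \<delta>: "0 < \<delta>"
  shows "\<exists>k l. 1 / (r ^ k * \<rho> ^ l) \<le> v \<and> v * (1 - \<delta>) \<le> 1 / (r ^ k * \<rho> ^ l)"
proof -
  have pos: "0 < r" "r < 1" "1 < \<rho>" using assms by (auto simp: NC_def)
  then have b: "0 < ln \<rho>" by simp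
  define \<theta> where "\<theta> = - ln r / ln \<rho>"
  have "\<theta> \<notin> \<rat>"
    using NC_irrational[OF assms(1)] Rats_minus_iff[of "ln r / ln \<rho>"] by (simp add: \<theta>_def)
  define \<eta> where "\<eta> = \<delta> / (2 * ln \<rho>)"
  \<comment> \<open>Centre of the target window: after multiplication by \<open>ln \<rho>\<close>,
    the points \<open>\<alpha> - \<eta>\<close> and \<open>\<alpha> + \<eta>\<close> become
    \<open>ln v - \<delta>\<close> and \<open>ln v\<close>.\<close>
  define \<alpha> where "\<alpha> = ln v / ln \<rho> - \<eta>"
  have \<eta>: "0 < \<eta>" using \<delta> b by (simp add: \<eta>_def)
  have "ln v / ln \<rho> \<le> 0" using v b by (simp add: divide_nonpos_pos)
  then have \<alpha>: "\<alpha> < 0" using \<eta> by (simp add: \<alpha>_def)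
  obtain k :: nat where k: "\<bar>frac (real k * \<theta>) - frac \<alpha>\<bar> < \<eta>"
    using Kronecker_approx_1_explicit[OF \<open>\<theta> \<notin> \<rat>\<close> _ _ \<eta>, of "frac \<alpha>"]
    by (metis frac_ge_0 frac_lt_1 less_imp_le)
  \<comment> \<open>The difference is non-negative because
    \<open>\<alpha> < 0 \<le> k * \<theta>\<close>, so \<open>nat\<close> loses nothing.\<close>
  define l where "l = nat (\<lfloor>real k * \<theta>\<rfloor> - \<lfloor>\<alpha>\<rfloor>)"
  have "0 \<le> \<theta>" using pos b by (simp add: \<theta>_def divide_nonpos_pos)
  then have "0 \<le> real k * \<theta>" by simp
  then have "\<lfloor>\<alpha>\<rfloor> \<le> \<lfloor>real k * \<theta>\<rfloor>" using \<alpha> by (intro floor_mono) simp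
  then have l: "real l = \<lfloor>real k * \<theta>\<rfloor> - \<lfloor>\<alpha>\<rfloor>" by (simp add: l_def)
  have close: "\<bar>real k * \<theta> - real l - \<alpha>\<bar> < \<eta>"
    using k unfolding l frac_def by (simp add: algebra_simps)
  define z where "z = (real k * \<theta> - real l) * ln \<rho>"
  have "z = - (real k * ln r + real l * ln \<rho>)"
    using b by (simp add: z_def \<theta>_def field_simps)
  then have z: "1 / (r ^ k * \<rho> ^ l) = exp z"
    using pos by (simp only: exp_minus exp_add exp_of_nat_mult) (simp add: field_simps)
  have "(\<alpha> - \<eta>) * ln \<rho> \<le> z" "z \<le> (\<alpha> + \<eta>) * ln \<rho>"
    unfolding z_def using close b by (auto intro!: mult_right_mono)
  moreover have "(\<alpha> - \<eta>) * ln \<rho> = ln v - \<delta>" "(\<alpha> + \<eta>) * ln \<rho> = ln v"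
    using b by (simp_all add: \<alpha>_def \<eta>_def field_simps)
  ultimately have "exp (ln v - \<delta>) \<le> exp z" "exp z \<le> exp (ln v)" by auto
  moreover have "v * (1 - \<delta>) \<le> exp (ln v - \<delta>)"
    using v exp_ge_add_one_self[of "-\<delta>"] by (simp add: exp_diff exp_minus divide_inverse)
  ultimately have "1 / (r ^ k * \<rho> ^ l) \<le> v \<and> v * (1 - \<delta>) \<le> 1 / (r ^ k * \<rho> ^ l)"
    unfolding z using exp_ln[OF v(1)] by linarith
  then show ?thesis by blast
qed

text \<open>Shrink \<open>x\<close> by a factor \<open>t\<close> near 1 so that coordinate
  \<open>n\<close> becomes a value from which 1 can be reached, and continue from there up to 1. The
  relative error in \<open>NC_dense\<close> is exactly the bound
  \<open>1 - \<delta> \<le> t\<close>.\<close>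

lemma (in mahavier) end_points_dense:
  assumes NC: "(r, \<rho>) \<in> NC" and x: "x \<in> M r \<rho>" "x \<noteq> (\<lambda>_. 0)"
  shows "x \<in> closure (end_points (M r \<rho>))"
proof (rule closure_seqI)
  fix n
  define \<delta> where "\<delta> = inverse (real (Suc n))"
  have \<delta>: "0 < \<delta>" by (simp add: \<delta>_def)
  have xn: "0 < x n" "x n \<le> 1" using x M_pos M_le_1 by auto
  obtain k l where kl: "1 / (r ^ k * \<rho> ^ l) \<le> x n" "x n * (1 - \<delta>) \<le> 1 / (r ^ k * \<rho> ^ l)"
    using NC_dense[OF NC xn \<delta>] by blast
  have "1 / (r ^ k * \<rho> ^ l) \<le> 1" using kl xn by linarith
  then obtain y j where y: "y \<in> M r \<rho>" "y 0 = 1 / (r ^ k * \<rho> ^ l)" "y j = 1"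
    using reaches_1 by blast
  define t where "t = y 0 / x n"
  have t: "0 \<le> t" "t \<le> 1" "1 - \<delta> \<le> t"
    using kl[folded y(2)] xn M_nonneg[OF y(1), of 0]
    by (simp_all add: t_def pos_le_divide_eq mult.commute)
  define z where "z = (\<lambda>i. if i < n then smul t x i else y (i - n))"
  have "z \<in> M r \<rho>"
    unfolding z_def using x t y xn by (intro splice_in_M smul_in_M) (auto simp: t_def)
  moreover have "z (n + j) = 1" using y by (simp add: z_def)
  ultimately have "z \<in> end_points (M r \<rho>)" by (rule end_pointI)
  moreover have "\<bar>z i - x i\<bar> \<le> \<delta>" if "i \<le> n" for i
  proof -
    \<comment> \<open>For \<open>i = n\<close> the second branch applies, with value
      \<open>y 0 = t * x n\<close>.\<close>
    have "z i = t * x i" using that xn by (auto simp: z_def t_def not_less)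
    then have "\<bar>z i - x i\<bar> = (1 - t) * x i"
      using mult_right_mono[OF t(2) M_nonneg[OF x(1), of i]] by (simp add: algebra_simps)
    also have "\<dots> \<le> \<delta> * 1"
      using t M_nonneg[OF x(1)] M_le_1[OF x(1)] \<delta> by (intro mult_mono) auto
    finally show ?thesis by simp
  qed
  ultimately show "\<exists>y\<in>end_points (M r \<rho>). \<forall>i\<le>n. \<bar>y i - x i\<bar> \<le> inverse (real (Suc n))"
    unfolding \<delta>_def by blast
qed

text \<open>The approximation by end-points treats nonzero points, whose coordinates are positive;
  the origin is then reached as a limit of such points.\<close>

lemma (in mahavier) zero_in_closure: "(\<lambda>_. 0) \<in> closure (M r \<rho> - {\<lambda>_. 0})"
proof (rule closure_seqI)
  fix n
  let ?y = "smul (inverse (real (Suc n))) (\<lambda>i. r ^ i)"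
  have "?y \<in> M r \<rho>" by (intro smul_in_M powers_in_M) (auto simp: divide_simps)
  moreover have "?y 0 \<noteq> 0" by simp
  then have "?y \<noteq> (\<lambda>_. 0)" by metis
  moreover have "\<bar>?y i - 0\<bar> \<le> inverse (real (Suc n))" for i
    using r_pos r_less mult_left_mono[of "r ^ i" 1 "inverse (real (Suc n))"]
    by (simp add: power_le_one)
  ultimately show "\<exists>y\<in>M r \<rho> - {\<lambda>_. 0}. \<forall>i\<le>n. \<bar>y i - 0\<bar> \<le> inverse (real (Suc n))"
    by blast
qed

theorem theorem4p34:
  fixes r \<rho> :: real
  assumes "(r, \<rho>) \<in> NC"
  shows "Lelek_fan (M r \<rho>)"
proof -
  interpret mahavier r \<rho>
    using assms by unfold_locales (auto simp: NC_def)
  have "M r \<rho> - {\<lambda>_. 0} \<subseteq> closure (end_points (M r \<rho>))"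
    using end_points_dense[OF assms] by blast
  then have "closure (M r \<rho> - {\<lambda>_. 0}) \<subseteq> closure (end_points (M r \<rho>))"
    by (simp add: closure_minimal)
  then have "M r \<rho> \<subseteq> closure (end_points (M r \<rho>))"
    using end_points_dense[OF assms] zero_in_closure by blast
  moreover have "closure (end_points (M r \<rho>)) \<subseteq> M r \<rho>"
    by (intro closure_minimal compact_imp_closed compact_M) (auto simp: end_points_def)
  ultimately show ?thesis
    using smooth_fan_M by (auto simp: Lelek_fan_def)
qed

end
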